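(* Let $\alpha: \mathcal{P}(\underline{m}) \to \mathcal{P}(\underline{n})$ be a poset monomorphism which preserves meets and joins, and let $K \subseteq \square^{m}$ be a cubical subcomplex. Then the induced functor $\alpha_{\ast}: P(K) \to P(K_{\alpha})$ is fully faithful.
   Context: Let $\underline{n}=\{1,2,\dots,n\}$ and let $\mathcal{P}(\underline{n})$ be the poset of its subsets (meets are intersections, joins are unions). For $A \subseteq B \subseteq \underline{n}$ write $[A,B]=\{F \mid A\subseteq F\subseteq B\}$. A (finite) cubical complex $K \subseteq \square^{n}$ is a set of intervals $[A,B]\subseteq \mathcal{P}(\underline{n})$ (its cells) closed under taking subintervals; its vertices are the $F\subseteq\underline{n}$ with $[F,F]\in K$. The triangulation $\vert K\vert$ is the subcomplex of the nerve $B\mathcal{P}(\underline{n})$ which is the union of the nerves $B[A,B]$ over the cells $[A,B]$ of $K$. The path category functor $X\mapsto P(X)$ from simplicial sets to small categories is the left adjoint of the nerve functor $B$: $P(X)$ has the vertices of $X$ as objects, and is the category freely generated by the $1$-simplices modulo the relations that degenerate $1$-simplices are identities and $d_{1}\sigma = d_{0}\sigma\circ d_{2}\sigma$ for each $2$-simplex $\sigma$. For a cubical complex $K$, $P(K):=P(\vert K\vert)$. For $\alpha$ and $K\subseteq\square^{m}$ as in the claim, $K_{\alpha}$ is the cubical subcomplex of $\square^{n}$ generated by the intervals $[\alpha(A),\alpha(B)]$ associated to the intervals (cells) $[A,B]$ of $K$, i.e. it consists of all subintervals of such intervals. The restrictions $\alpha:[A,B]\to[\alpha(A),\alpha(B)]$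 induce a simplicial set map $\alpha_{\ast}:\vert K\vert\to\vert K_{\alpha}\vert$, which is the restriction of $B\alpha: B\mathcal{P}(\underline{m})\to B\mathcal{P}(\underline{n})$, and hence a functor $\alpha_{\ast}:P(K)\to P(K_{\alpha})$. A functor is fully faithful if it induces bijections on all morphism sets. *)

theory Defs
  imports Main
begin

section \<open>Simplicial sets\<close>

text \<open>
  All simplices live in one type. The dimension is an explicit argument of the
  structure maps: \<open>face X n i\<close> is \<open>d\<^sub>i\<close> on \<open>n\<close>-simplices and \<open>degen X n i\<close> is
  \<open>s\<^sub>i\<close> on \<open>n\<close>-simplices.
\<close>

record 'a sset =
  simplices :: "nat \<Rightarrow> 'a set"
  face :: "nat \<Rightarrow> nat \<Rightarrow> 'a \<Rightarrow> 'a"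
  degen :: "nat \<Rightarrow> nat \<Rightarrow> 'a \<Rightarrow> 'a"

locale simplicial_set =
  fixes X :: "'a sset"
  assumes face_closed:
      "\<lbrakk>x \<in> simplices X (Suc n); i \<le> Suc n\<rbrakk> \<Longrightarrow> face X (Suc n) i x \<in> simplices X n"
    and degen_closed:
      "\<lbrakk>x \<in> simplices X n; i \<le> n\<rbrakk> \<Longrightarrow> degen X n i x \<in> simplices X (Suc n)"
    and face_face:
      "\<lbrakk>x \<in> simplices X (Suc (Suc n)); i < j; j \<le> Suc (Suc n)\<rbrakk>
        \<Longrightarrow> face X (Suc n) i (face X (Suc (Suc n)) j x)
          = face X (Suc n) (j - 1) (face X (Suc (Suc n)) i x)"
    and face_degen_less:
      "\<lbrakk>x \<in> simplices X (Suc n); i < j; j \<le> Suc n\<rbrakk>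
        \<Longrightarrow> face X (Suc (Suc n)) i (degen X (Suc n) j x) = degen X n (j - 1) (face X (Suc n) i x)"
    and face_degen_same:
      "\<lbrakk>x \<in> simplices X n; j \<le> n; i = j \<or> i = Suc j\<rbrakk>
        \<Longrightarrow> face X (Suc n) i (degen X n j x) = x"
    and face_degen_greater:
      "\<lbrakk>x \<in> simplices X (Suc n); Suc j < i; i \<le> Suc (Suc n)\<rbrakk>
        \<Longrightarrow> face X (Suc (Suc n)) i (degen X (Suc n) j x) = degen X n j (face X (Suc n) (i - 1) x)"
    and degen_degen:
      "\<lbrakk>x \<in> simplices X n; i \<le> j; j \<le> n\<rbrakk>
        \<Longrightarrow> degen X (Suc n) i (degen X n j x) = degen X (Suc n) (Suc j) (degen X n i x)"

locale simplicial_map = X: simplicial_set X + Y: simplicial_set Y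
  for X :: "'a sset" and Y :: "'b sset" +
  fixes \<phi> :: "nat \<Rightarrow> 'a \<Rightarrow> 'b"
  assumes map_closed: "x \<in> simplices X n \<Longrightarrow> \<phi> n x \<in> simplices Y n"
    and map_face: "\<lbrakk>x \<in> simplices X (Suc n); i \<le> Suc n\<rbrakk>
        \<Longrightarrow> \<phi> n (face X (Suc n) i x) = face Y (Suc n) i (\<phi> (Suc n) x)"
    and map_degen: "\<lbrakk>x \<in> simplices X n; i \<le> n\<rbrakk>
        \<Longrightarrow> \<phi> (Suc n) (degen X n i x) = degen Y n i (\<phi> n x)"


section \<open>Categories and functors\<close>

text \<open>\<open>cmp C g f\<close> is the composite \<open>g \<circ> f\<close>.\<close>

record ('o, 'm) cat =
  ob :: "'o set"
  hom :: "'o \<Rightarrow> 'o \<Rightarrow> 'm set"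
  ident :: "'o \<Rightarrow> 'm"
  cmp :: "'m \<Rightarrow> 'm \<Rightarrow> 'm"

locale category =
  fixes C :: "('o, 'm) cat"
  assumes ident_hom: "x \<in> ob C \<Longrightarrow> ident C x \<in> hom C x x"
    and cmp_hom: "\<lbrakk>x \<in> ob C; y \<in> ob C; z \<in> ob C; f \<in> hom C x y; g \<in> hom C y z\<rbrakk>
        \<Longrightarrow> cmp C g f \<in> hom C x z"
    and cmp_ident: "\<lbrakk>x \<in> ob C; y \<in> ob C; f \<in> hom C x y\<rbrakk> \<Longrightarrow> cmp C f (ident C x) = f"
    and ident_cmp: "\<lbrakk>x \<in> ob C; y \<in> ob C; f \<in> hom C x y\<rbrakk> \<Longrightarrow> cmp C (ident C y) f = f"
    and cmp_assoc: "\<lbrakk>w \<in> ob C; x \<in> ob C; y \<in> ob C; z \<in> ob C;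
          f \<in> hom C w x; g \<in> hom C x y; h \<in> hom C y z\<rbrakk>
        \<Longrightarrow> cmp C h (cmp C g f) = cmp C (cmp C h g) f"

record ('o, 'm, 'p, 'q) ftr =
  on_ob :: "'o \<Rightarrow> 'p"
  on_hom :: "'m \<Rightarrow> 'q"

locale cat_functor = C: category C + D: category D
  for C :: "('o, 'm) cat" and D :: "('p, 'q) cat" +
  fixes \<Phi> :: "('o, 'm, 'p, 'q) ftr"
  assumes on_ob_closed: "x \<in> ob C \<Longrightarrow> on_ob \<Phi> x \<in> ob D"
    and on_hom_closed: "\<lbrakk>x \<in> ob C; y \<in> ob C; f \<in> hom C x y\<rbrakk>
        \<Longrightarrow> on_hom \<Phi> f \<in> hom D (on_ob \<Phi> x) (on_ob \<Phi> y)"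
    and on_hom_ident: "x \<in> ob C \<Longrightarrow> on_hom \<Phi> (ident C x) = ident D (on_ob \<Phi> x)"
    and on_hom_cmp: "\<lbrakk>x \<in> ob C; y \<in> ob C; z \<in> ob C; f \<in> hom C x y; g \<in> hom C y z\<rbrakk>
        \<Longrightarrow> on_hom \<Phi> (cmp C g f) = cmp D (on_hom \<Phi> g) (on_hom \<Phi> f)"

locale fully_faithful = cat_functor +
  assumes bij_hom: "\<lbrakk>x \<in> ob C; y \<in> ob C\<rbrakk>
    \<Longrightarrow> bij_betw (on_hom \<Phi>) (hom C x y) (hom D (on_ob \<Phi> x) (on_ob \<Phi> y))"


section \<open>The path category of a simplicial set\<close>

text \<open>
  A morphism \<open>x \<rightarrow> y\<close> of the free category on the graph of 1-simplices is a triple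
  \<open>(x, es, y)\<close>, where \<open>es\<close> is the list of edges in the order in which they are
  traversed. A 1-simplex \<open>e\<close> points from \<open>d\<^sub>1 e\<close> to \<open>d\<^sub>0 e\<close>.
\<close>

type_synonym 'a path = "'a \<times> 'a list \<times> 'a"

inductive is_path :: "'a sset \<Rightarrow> 'a path \<Rightarrow> bool" for X where
  empty: "x \<in> simplices X 0 \<Longrightarrow> is_path X (x, [], x)"
| edge: "\<lbrakk>e \<in> simplices X 1; is_path X (face X 1 0 e, es, y)\<rbrakk>
    \<Longrightarrow> is_path X (face X 1 1 e, e # es, y)"

text \<open>
  The least congruence on the free category that contains the relations given by the
  degenerate 1-simplices and by the 2-simplices.
\<close>

inductive path_rel :: "'a sset \<Rightarrow> 'a path \<Rightarrow> 'a path \<Rightarrow> bool" for X where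
  degenerate: "x \<in> simplices X 0 \<Longrightarrow> path_rel X (x, [degen X 0 0 x], x) (x, [], x)"
| triangle: "\<sigma> \<in> simplices X 2 \<Longrightarrow>
    path_rel X
      (face X 1 1 (face X 2 1 \<sigma>), [face X 2 1 \<sigma>], face X 1 0 (face X 2 1 \<sigma>))
      (face X 1 1 (face X 2 2 \<sigma>), [face X 2 2 \<sigma>, face X 2 0 \<sigma>], face X 1 0 (face X 2 0 \<sigma>))"
| refl: "is_path X p \<Longrightarrow> path_rel X p p"
| sym: "path_rel X p q \<Longrightarrow> path_rel X q p"
| trans: "\<lbrakk>path_rel X p q; path_rel X q r\<rbrakk> \<Longrightarrow> path_rel X p r"
| append: "\<lbrakk>path_rel X (x, es, y) (x, es', y); path_rel X (y, fs, z) (y, fs', z)\<rbrakk>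
    \<Longrightarrow> path_rel X (x, es @ fs, z) (x, es' @ fs', z)"

definition path_class :: "'a sset \<Rightarrow> 'a path \<Rightarrow> 'a path set" where
  "path_class X p = {q. path_rel X p q}"

definition path_category :: "'a sset \<Rightarrow> ('a, 'a path set) cat" where
  "path_category X = \<lparr>
     ob = simplices X 0,
     hom = (\<lambda>x y. {path_class X (x, es, y) | es. is_path X (x, es, y)}),
     ident = (\<lambda>x. path_class X (x, [], x)),
     cmp = (\<lambda>g f. \<Union> {path_class X (x, es @ fs, z) | x es y fs z. (x, es, y) \<in> f \<and> (y, fs, z) \<in> g})\<rparr>"

fun map_path :: "(nat \<Rightarrow> 'a \<Rightarrow> 'b) \<Rightarrow> 'a path \<Rightarrow> 'b path" where
  "map_path \<phi> (x, es, y) = (\<phi> 0 x, map (\<phi> 1) es, \<phi> 0 y)"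

text \<open>The functor \<open>P(X) \<rightarrow> P(Y)\<close> induced by a simplicial map \<open>\<phi> : X \<rightarrow> Y\<close>; it depends on \<open>Y\<close> through
  the formation of classes.\<close>

definition path_functor ::
  "'b sset \<Rightarrow> (nat \<Rightarrow> 'a \<Rightarrow> 'b) \<Rightarrow> ('a, 'a path set, 'b, 'b path set) ftr" where
  "path_functor Y \<phi> = \<lparr>
     on_ob = \<phi> 0,
     on_hom = (\<lambda>c. \<Union> {path_class Y (map_path \<phi> p) | p. p \<in> c})\<rparr>"


section \<open>Nerves of posets\<close>

text \<open>
  A \<open>k\<close>-simplex of the nerve of a poset is a weakly increasing chain
  \<open>x\<^sub>0 \<le> \<dots> \<le> x\<^sub>k\<close>, represented as a list of length \<open>k + 1\<close>. The face \<open>d\<^sub>i\<close> omits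
  \<open>x\<^sub>i\<close> and the degeneracy \<open>s\<^sub>i\<close> repeats it.
\<close>

definition nerve :: "'a::order set \<Rightarrow> 'a list sset" where
  "nerve S = \<lparr>
     simplices = (\<lambda>k. {xs. length xs = Suc k \<and> set xs \<subseteq> S \<and> sorted_wrt (\<le>) xs}),
     face = (\<lambda>k i xs. take i xs @ drop (Suc i) xs),
     degen = (\<lambda>k i xs. take (Suc i) xs @ drop i xs)\<rparr>"

definition nerve_map :: "('a \<Rightarrow> 'b) \<Rightarrow> nat \<Rightarrow> 'a list \<Rightarrow> 'b list" where
  "nerve_map \<alpha> k = map \<alpha>"


section \<open>Cubical complexes\<close>

text \<open>
  The interval \<open>[A, B]\<close> is the library's \<open>{A..B} = {F. A \<subseteq> F \<and> F \<subseteq> B}\<close>. Only nonempty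
  intervals, those with \<open>A \<subseteq> B\<close>, are cells.
\<close>

definition cubical_complex :: "nat \<Rightarrow> nat set set set \<Rightarrow> bool" where
  "cubical_complex n K \<longleftrightarrow>
     (\<forall>c\<in>K. \<exists>A B. A \<subseteq> B \<and> B \<subseteq> {1..n} \<and> c = {A..B}) \<and>
     (\<forall>A B C D. {A..B} \<in> K \<and> A \<subseteq> C \<and> C \<subseteq> D \<and> D \<subseteq> B \<longrightarrow> {C..D} \<in> K)"

definition triangulation :: "nat set set set \<Rightarrow> nat set list sset" where
  "triangulation K = (nerve UNIV)\<lparr>simplices := (\<lambda>k. \<Union>c\<in>K. simplices (nerve c) k)\<rparr>"

definition cubical_image :: "(nat set \<Rightarrow> nat set) \<Rightarrow> nat set set set \<Rightarrow> nat set set set" where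
  "cubical_image \<alpha> K =
     {{C..D} | C D. C \<subseteq> D \<and> (\<exists>A B. A \<subseteq> B \<and> {A..B} \<in> K \<and> \<alpha> A \<subseteq> C \<and> D \<subseteq> \<alpha> B)}"

definition cubical_path_category :: "nat set set set \<Rightarrow> (nat set list, nat set list path set) cat" where
  "cubical_path_category K = path_category (triangulation K)"

definition cubical_path_functor :: "(nat set \<Rightarrow> nat set) \<Rightarrow> nat set set set
    \<Rightarrow> (nat set list, nat set list path set, nat set list, nat set list path set) ftr" where
  "cubical_path_functor \<alpha> K = path_functor (triangulation (cubical_image \<alpha> K)) (nerve_map \<alpha>)"


section \<open>Well-definedness\<close>

definition omit :: "nat \<Rightarrow> 'a list \<Rightarrow> 'a list" where
  "omit i xs = take i xs @ drop (Suc i) xs"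

definition repeat :: "nat \<Rightarrow> 'a list \<Rightarrow> 'a list" where
  "repeat i xs = take (Suc i) xs @ drop i xs"

lemma length_omit: "i < length xs \<Longrightarrow> length (omit i xs) = length xs - 1"
  and length_repeat: "i < length xs \<Longrightarrow> length (repeat i xs) = Suc (length xs)"
  by (auto simp: omit_def repeat_def)

lemma nth_omit: "\<lbrakk>i < length xs; k < length xs - 1\<rbrakk> \<Longrightarrow> omit i xs ! k = xs ! (if k < i then k else Suc k)"
  by (auto simp: omit_def nth_append)

lemma nth_repeat: "\<lbrakk>i < length xs; k \<le> length xs\<rbrakk> \<Longrightarrow> repeat i xs ! k = xs ! (if k \<le> i then k else k - 1)"
proof -
  assume "i < length xs" "k \<le> length xs"
  then have "k = length xs \<Longrightarrow> \<not> k \<le> Suc i \<or> k - 1 = i"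
    by linarith
  with \<open>i < length xs\<close> \<open>k \<le> length xs\<close> show ?thesis
    by (cases "k \<le> i") (auto simp: repeat_def nth_append min_def)
qed

lemma simplices_nerve:
    "simplices (nerve S) k = {xs. length xs = Suc k \<and> set xs \<subseteq> S \<and> sorted_wrt (\<le>) xs}"
  and face_nerve: "face (nerve S) k i = omit i"
  and degen_nerve: "degen (nerve S) k i = repeat i"
  by (auto simp: nerve_def omit_def repeat_def)

lemma simplicial_set_nerve: "simplicial_set (nerve S)"
proof unfold_locales
  fix n i and x :: "'a list"
  assume x: "x \<in> simplices (nerve S) (Suc n)" and i: "i \<le> Suc n"
  have "sorted_wrt (\<le>) (take i x @ drop i x)"
    using x by (simp add: nerve_def)
  then have "\<forall>a\<in>set (take i x). \<forall>b\<in>set (drop i x). a \<le> b"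
    unfolding sorted_wrt_append by blast
  moreover have "set (drop (Suc i) x) \<subseteq> set (drop i x)"
    by (simp add: set_drop_subset_set_drop)
  moreover have "sorted_wrt (\<le>) (take i x)" "sorted_wrt (\<le>) (drop (Suc i) x)"
    using x by (simp_all add: nerve_def)
  ultimately have "sorted_wrt (\<le>) (take i x @ drop (Suc i) x)"
    unfolding sorted_wrt_append by blast
  then show "face (nerve S) (Suc n) i x \<in> simplices (nerve S) n"
    using x i by (auto simp: nerve_def dest: in_set_takeD in_set_dropD)
next
  fix n i and x :: "'a list"
  assume x: "x \<in> simplices (nerve S) n" and i: "i \<le> n"
  have "i < length x" using x i by (simp add: nerve_def)
  then have d: "drop i x = x ! i # drop (Suc i) x" and t: "take (Suc i) x = take i x @ [x ! i]"
    by (simp_all add: Cons_nth_drop_Suc take_Suc_conv_app_nth)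
  have "sorted_wrt (\<le>) (take i x @ drop i x)"
    using x by (simp add: nerve_def)
  then have "sorted_wrt (\<le>) (take (Suc i) x @ drop i x)"
    unfolding t d by (auto simp: sorted_wrt_append)
  then show "degen (nerve S) n i x \<in> simplices (nerve S) (Suc n)"
    using x i by (auto simp: nerve_def dest: in_set_takeD in_set_dropD)
next
  fix n i j and x :: "'a list"
  assume a: "x \<in> simplices (nerve S) (Suc (Suc n))" "i < j" "j \<le> Suc (Suc n)"
  then show "face (nerve S) (Suc n) i (face (nerve S) (Suc (Suc n)) j x)
      = face (nerve S) (Suc n) (j - 1) (face (nerve S) (Suc (Suc n)) i x)"
    by (intro nth_equalityI)
      (auto simp: simplices_nerve face_nerve degen_nerve length_omit length_repeat nth_omit nth_repeat)
next
  fix n i j and x :: "'a list"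
  assume a: "x \<in> simplices (nerve S) (Suc n)" "i < j" "j \<le> Suc n"
  then show "face (nerve S) (Suc (Suc n)) i (degen (nerve S) (Suc n) j x)
      = degen (nerve S) n (j - 1) (face (nerve S) (Suc n) i x)"
    by (intro nth_equalityI)
      (auto simp: simplices_nerve face_nerve degen_nerve length_omit length_repeat nth_omit nth_repeat)
next
  fix n i j and x :: "'a list"
  assume a: "x \<in> simplices (nerve S) n" "j \<le> n" "i = j \<or> i = Suc j"
  then show "face (nerve S) (Suc n) i (degen (nerve S) n j x) = x"
    by (intro nth_equalityI)
      (auto simp: simplices_nerve face_nerve degen_nerve length_omit length_repeat nth_omit nth_repeat)
next
  fix n i j and x :: "'a list"
  assume a: "x \<in> simplices (nerve S) (Suc n)" "Suc j < i" "i \<le> Suc (Suc n)"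
  then show "face (nerve S) (Suc (Suc n)) i (degen (nerve S) (Suc n) j x)
      = degen (nerve S) n j (face (nerve S) (Suc n) (i - 1) x)"
    by (intro nth_equalityI)
      (auto simp: simplices_nerve face_nerve degen_nerve length_omit length_repeat nth_omit nth_repeat)
next
  fix n i j and x :: "'a list"
  assume a: "x \<in> simplices (nerve S) n" "i \<le> j" "j \<le> n"
  then show "degen (nerve S) (Suc n) i (degen (nerve S) n j x)
      = degen (nerve S) (Suc n) (Suc j) (degen (nerve S) n i x)"
    by (intro nth_equalityI)
      (auto simp: simplices_nerve face_nerve degen_nerve length_omit length_repeat nth_omit nth_repeat)
qed

lemma simplices_triangulation: "simplices (triangulation K) k = (\<Union>c\<in>K. simplices (nerve c) k)"
  and face_triangulation: "face (triangulation K) = face (nerve S)"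
  and degen_triangulation: "degen (triangulation K) = degen (nerve S)"
  by (simp_all add: triangulation_def nerve_def)

lemma simplicial_set_triangulation: "simplicial_set (triangulation K)"
proof -
  interpret N: simplicial_set "nerve (UNIV :: nat set set)"
    by (rule simplicial_set_nerve)
  have sub: "x \<in> simplices (triangulation K) n \<Longrightarrow> x \<in> simplices (nerve UNIV) n" for x n
    by (auto simp: simplices_triangulation simplices_nerve)
  note fd = face_triangulation[where S = UNIV] degen_triangulation[where S = UNIV]
  show ?thesis
  proof
    fix x n i assume "x \<in> simplices (triangulation K) (Suc n)" and i: "i \<le> Suc n"
    then obtain c where c: "c \<in> K" "x \<in> simplices (nerve c) (Suc n)"
      by (auto simp: simplices_triangulation)
    then have "face (nerve c) (Suc n) i x \<in> simplices (nerve c) n"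
      using simplicial_set.face_closed[OF simplicial_set_nerve _ i] by blast
    then show "face (triangulation K) (Suc n) i x \<in> simplices (triangulation K) n"
      using c(1) by (auto simp: simplices_triangulation face_triangulation[where S = c])
  next
    fix x n i assume "x \<in> simplices (triangulation K) n" and i: "i \<le> n"
    then obtain c where c: "c \<in> K" "x \<in> simplices (nerve c) n"
      by (auto simp: simplices_triangulation)
    then have "degen (nerve c) n i x \<in> simplices (nerve c) (Suc n)"
      using simplicial_set.degen_closed[OF simplicial_set_nerve _ i] by blast
    then show "degen (triangulation K) n i x \<in> simplices (triangulation K) (Suc n)"
      using c(1) by (auto simp: simplices_triangulation degen_triangulation[where S = c])
  next
    fix n i j and x :: "nat set list"
    assume a: "x \<in> simplices (triangulation K) (Suc (Suc n))" "i < j" "j \<le> Suc (Suc n)"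
    then show "face (triangulation K) (Suc n) i (face (triangulation K) (Suc (Suc n)) j x)
        = face (triangulation K) (Suc n) (j - 1) (face (triangulation K) (Suc (Suc n)) i x)"
      using N.face_face[OF sub[OF a(1)] a(2,3)] by (simp only: fd)
  next
    fix n i j and x :: "nat set list"
    assume a: "x \<in> simplices (triangulation K) (Suc n)" "i < j" "j \<le> Suc n"
    then show "face (triangulation K) (Suc (Suc n)) i (degen (triangulation K) (Suc n) j x)
        = degen (triangulation K) n (j - 1) (face (triangulation K) (Suc n) i x)"
      using N.face_degen_less[OF sub[OF a(1)] a(2,3)] by (simp only: fd)
  next
    fix n i j and x :: "nat set list"
    assume a: "x \<in> simplices (triangulation K) n" "j \<le> n" "i = j \<or> i = Suc j"
    then show "face (triangulation K) (Suc n) i (degen (triangulation K) n j x) = x"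
      using N.face_degen_same[OF sub[OF a(1)] a(2,3)] by (simp only: fd)
  next
    fix n i j and x :: "nat set list"
    assume a: "x \<in> simplices (triangulation K) (Suc n)" "Suc j < i" "i \<le> Suc (Suc n)"
    then show "face (triangulation K) (Suc (Suc n)) i (degen (triangulation K) (Suc n) j x)
        = degen (triangulation K) n j (face (triangulation K) (Suc n) (i - 1) x)"
      using N.face_degen_greater[OF sub[OF a(1)] a(2,3)] by (simp only: fd)
  next
    fix n i j and x :: "nat set list"
    assume a: "x \<in> simplices (triangulation K) n" "i \<le> j" "j \<le> n"
    then show "degen (triangulation K) (Suc n) i (degen (triangulation K) n j x)
        = degen (triangulation K) (Suc n) (Suc j) (degen (triangulation K) n i x)"
      using N.degen_degen[OF sub[OF a(1)] a(2,3)] by (simp only: fd)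
  qed
qed

lemma triangulation_subset_nerve:
  assumes "cubical_complex n K"
  shows "simplices (triangulation K) k \<subseteq> simplices (nerve (Pow {1..n})) k"
proof -
  have "c \<subseteq> Pow {1..n}" if "c \<in> K" for c
    using assms that unfolding cubical_complex_def by (metis PowI atLeastAtMost_iff order_trans subsetI)
  then show ?thesis
    by (fastforce simp: simplices_triangulation simplices_nerve)
qed

lemma cubical_complex_image:
  assumes "cubical_complex m K" and "\<alpha> ` Pow {1..m} \<subseteq> Pow {1..n}"
  shows "cubical_complex n (cubical_image \<alpha> K)"
proof -
  have cell: "A \<subseteq> B \<Longrightarrow> {A..B} \<in> K \<Longrightarrow> B \<subseteq> {1..m}" for A B
    using assms(1) unfolding cubical_complex_def by (metis Icc_eq_Icc)
  have 1: "\<exists>A B. A \<subseteq> B \<and> B \<subseteq> {1..n} \<and> c = {A..B}" if c: "c \<in> cubical_image \<alpha> K" for c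
  proof -
    obtain C D A B where *: "c = {C..D}" "C \<subseteq> D" "A \<subseteq> B" "{A..B} \<in> K" "D \<subseteq> \<alpha> B"
      using c unfolding cubical_image_def by blast
    have "\<alpha> B \<subseteq> {1..n}"
      using cell[OF *(3,4)] assms(2) by blast
    then show ?thesis
      using *(1,2,5) by (intro exI[of _ C] exI[of _ D]) simp
  qed
  have 2: "{C..D} \<in> cubical_image \<alpha> K"
    if AB: "{A..B} \<in> cubical_image \<alpha> K" and CD: "A \<subseteq> C" "C \<subseteq> D" "D \<subseteq> B" for A B C D
  proof -
    obtain C' D' A' B' where *: "{A..B} = {C'..D'}" "C' \<subseteq> D'" "A' \<subseteq> B'" "{A'..B'} \<in> K"
      "\<alpha> A' \<subseteq> C'" "D' \<subseteq> \<alpha> B'"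
      using AB unfolding cubical_image_def mem_Collect_eq by (elim exE conjE) (rule that)
    then have "A = C'" "B = D'"
      by (auto simp: Icc_eq_Icc)
    then show ?thesis
      using *(3-6) CD unfolding cubical_image_def mem_Collect_eq
      by (intro exI[of _ C] exI[of _ D] conjI exI[of _ A'] exI[of _ B']) simp_all
  qed
  show ?thesis
    unfolding cubical_complex_def
    by (intro conjI ballI allI impI; (elim conjE)?) (erule 1, erule (3) 2)
qed

lemma is_path_endpoints:
  assumes "is_path X (x, es, y)" and "simplicial_set X"
  shows "x \<in> simplices X 0 \<and> y \<in> simplices X 0"
  using assms
proof (induction "(x, es, y)" arbitrary: x es rule: is_path.induct)
  case (edge e es)
  then show ?case
    using simplicial_set.face_closed[of X e 0 1] by simp
qed simp

lemma is_path_append: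
  assumes "is_path X (x, es, y)" and "is_path X (y, fs, z)"
  shows "is_path X (x, es @ fs, z)"
  using assms
  by (induction "(x, es, y)" arbitrary: x es rule: is_path.induct)
    (auto simp del: One_nat_def intro: is_path.edge)

lemma is_path_single:
  assumes "simplicial_set X" and "e \<in> simplices X 1"
  shows "is_path X (face X 1 1 e, [e], face X 1 0 e)"
proof -
  have "face X 1 0 e \<in> simplices X 0"
    using simplicial_set.face_closed[OF assms(1), of e 0 0] assms(2) by simp
  then show ?thesis
    by (intro is_path.intros assms(2))
qed

lemma path_rel_paths:
  assumes "path_rel X p q" and X: "simplicial_set X"
  shows "is_path X p \<and> is_path X q \<and> fst p = fst q \<and> snd (snd p) = snd (snd q)"
  using assms(1)
proof induction
  case (degenerate x)
  have "degen X 0 0 x \<in> simplices X 1"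
    using simplicial_set.degen_closed[OF X degenerate, of 0] by simp
  moreover have "face X 1 i (degen X 0 0 x) = x" if "i = 0 \<or> i = 1" for i
    using simplicial_set.face_degen_same[OF X degenerate, of 0 i] that by auto
  ultimately show ?case
    using is_path_single[OF X, of "degen X 0 0 x"] degenerate by (auto intro: is_path.empty)
next
  case (triangle s)
  have s: "s \<in> simplices X (Suc (Suc 0))"
    using triangle by (simp add: numeral_2_eq_2)
  have f: "face X 2 i s \<in> simplices X 1" if "i \<le> 2" for i
    using simplicial_set.face_closed[OF X s, of i] that by (simp add: numeral_2_eq_2)
  have e: "face X 1 1 (face X 2 1 s) = face X 1 1 (face X 2 2 s)"
    "face X 1 0 (face X 2 1 s) = face X 1 0 (face X 2 0 s)"
    "face X 1 0 (face X 2 2 s) = face X 1 1 (face X 2 0 s)"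
    using simplicial_set.face_face[OF X s, of 1 2] simplicial_set.face_face[OF X s, of 0 1]
      simplicial_set.face_face[OF X s, of 0 2] by (simp_all add: numeral_2_eq_2)
  have "is_path X (face X 1 1 (face X 2 2 s), [face X 2 2 s] @ [face X 2 0 s],
      face X 1 0 (face X 2 0 s))"
    by (rule is_path_append[OF is_path_single[OF X f] is_path_single[OF X f, of 0, folded e(3)]])
      simp_all
  then show ?case
    using is_path_single[OF X f, of 1] e by simp
qed (auto intro: is_path_append)

lemma path_class_eqI: "path_rel X p q \<Longrightarrow> path_class X p = path_class X q"
  unfolding path_class_def by (blast intro: path_rel.sym path_rel.trans)

lemma cmp_path_class:
  assumes X: "simplicial_set X" and p: "is_path X (x, es, y)" and q: "is_path X (y, fs, z)"
  shows "cmp (path_category X) (path_class X (y, fs, z)) (path_class X (x, es, y))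
    = path_class X (x, es @ fs, z)"
proof -
  have "{path_class X (x', es' @ fs', z') | x' es' y' fs' z'.
        (x', es', y') \<in> path_class X (x, es, y) \<and> (y', fs', z') \<in> path_class X (y, fs, z)}
      = {path_class X (x, es @ fs, z)}" (is "?L = ?R")
  proof
    show "?L \<subseteq> ?R"
    proof
      fix c assume "c \<in> ?L"
      then obtain x' es' y' fs' z' where c: "c = path_class X (x', es' @ fs', z')"
        and r: "path_rel X (x, es, y) (x', es', y')" "path_rel X (y, fs, z) (y', fs', z')"
        by (auto simp: path_class_def)
      with path_rel_paths[OF r(1) X] path_rel_paths[OF r(2) X]
      have "path_rel X (x, es @ fs, z) (x', es' @ fs', z')"
        by (auto intro: path_rel.append)
      then show "c \<in> ?R"
        using c path_class_eqI by fastforce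
    qed
    show "?R \<subseteq> ?L"
      using path_rel.refl[OF p] path_rel.refl[OF q] unfolding path_class_def mem_Collect_eq by blast
  qed
  then show ?thesis
    by (simp add: path_category_def)
qed

lemma category_path_category:
  assumes X: "simplicial_set X"
  shows "category (path_category X)"
proof
  fix x assume "x \<in> ob (path_category X)"
  then show "ident (path_category X) x \<in> hom (path_category X) x x"
    by (auto simp: path_category_def intro: is_path.empty)
next
  fix x y z f g
  assume "f \<in> hom (path_category X) x y" "g \<in> hom (path_category X) y z"
  then obtain es fs where "f = path_class X (x, es, y)" "is_path X (x, es, y)"
    "g = path_class X (y, fs, z)" "is_path X (y, fs, z)"
    by (auto simp: path_category_def)
  with cmp_path_class[OF X] is_path_append
  show "cmp (path_category X) g f \<in> hom (path_category X) x z"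
    by (fastforce simp: path_category_def)
next
  fix x y f
  assume xy: "x \<in> ob (path_category X)" "y \<in> ob (path_category X)"
    and "f \<in> hom (path_category X) x y"
  then obtain es where f: "f = path_class X (x, es, y)" "is_path X (x, es, y)"
    by (auto simp: path_category_def)
  have e: "is_path X (x, [], x)" "is_path X (y, [], y)"
    using xy by (auto simp: path_category_def intro: is_path.empty)
  have i: "ident (path_category X) v = path_class X (v, [], v)" for v
    by (simp add: path_category_def)
  show "cmp (path_category X) f (ident (path_category X) x) = f"
    using cmp_path_class[OF X e(1) f(2)] by (simp add: i f)
  show "cmp (path_category X) (ident (path_category X) y) f = f"
    using cmp_path_class[OF X f(2) e(2)] by (simp add: i f)
next
  fix w x y z f g h
  assume "f \<in> hom (path_category X) w x" "g \<in> hom (path_category X) x y"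
    "h \<in> hom (path_category X) y z"
  then obtain es fs gs where
    "f = path_class X (w, es, x)" "is_path X (w, es, x)"
    "g = path_class X (x, fs, y)" "is_path X (x, fs, y)"
    "h = path_class X (y, gs, z)" "is_path X (y, gs, z)"
    by (auto simp: path_category_def)
  then show "cmp (path_category X) h (cmp (path_category X) g f)
      = cmp (path_category X) (cmp (path_category X) h g) f"
    by (simp add: cmp_path_class[OF X] is_path_append)
qed

lemma (in simplicial_map) is_path_map:
  assumes "is_path X (x, es, y)"
  shows "is_path Y (map_path \<phi> (x, es, y))"
  using assms
proof (induction "(x, es, y)" arbitrary: x es rule: is_path.induct)
  case empty
  then show ?case by (simp add: map_closed is_path.empty)
next
  case (edge e es)
  have "\<phi> 0 (face X 1 i e) = face Y 1 i (\<phi> 1 e)" if "i \<le> 1" for i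
    using map_face[of e 0 i] edge(1) that by simp
  then show ?case
    using edge map_closed[of e 1] by (auto simp del: One_nat_def intro: is_path.edge)
qed

lemma (in simplicial_map) path_rel_map:
  assumes "path_rel X p q"
  shows "path_rel Y (map_path \<phi> p) (map_path \<phi> q)"
  using assms
proof induction
  case (degenerate x)
  then show ?case
    using map_degen[of x 0 0] map_closed[of x 0] by (auto intro: path_rel.degenerate)
next
  case (triangle s)
  have s: "s \<in> simplices X (Suc (Suc 0))"
    using triangle by (simp add: numeral_2_eq_2)
  have 2: "\<phi> 1 (face X 2 i s) = face Y 2 i (\<phi> 2 s)" if "i \<le> 2" for i
    using map_face[OF s, of i] that by (simp add: numeral_2_eq_2)
  have 1: "\<phi> 0 (face X 1 j (face X 2 i s)) = face Y 1 j (face Y 2 i (\<phi> 2 s))"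
    if "i \<le> 2" "j \<le> 1" for i j
    using map_face[of "face X 2 i s" 0 j] X.face_closed[OF s, of i] that 2[of i]
    by (simp add: numeral_2_eq_2)
  show ?case
    using path_rel.triangle[OF map_closed[OF triangle]] by (simp add: 1 2 del: One_nat_def)
next
  case (refl p)
  then show ?case
    by (cases p) (metis is_path_map path_rel.refl)
next
  case (append x es es' y fs fs' z)
  then show ?case
    by (auto intro: path_rel.append)
qed (blast intro: path_rel.sym path_rel.trans)+

lemma (in simplicial_map) on_hom_path_class:
  assumes "is_path X p"
  shows "on_hom (path_functor Y \<phi>) (path_class X p) = path_class Y (map_path \<phi> p)"
proof -
  have "{path_class Y (map_path \<phi> q) | q. q \<in> path_class X p} = {path_class Y (map_path \<phi> p)}"
    using path_rel.refl[OF assms] path_class_eqI[OF path_rel_map]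
    unfolding path_class_def[of X] by blast
  then show ?thesis by (simp add: path_functor_def)
qed

lemma (in simplicial_map) cat_functor_path_functor:
  "cat_functor (path_category X) (path_category Y) (path_functor Y \<phi>)"
proof -
  interpret C: category "path_category X"
    by (rule category_path_category) (rule X.simplicial_set_axioms)
  interpret D: category "path_category Y"
    by (rule category_path_category) (rule Y.simplicial_set_axioms)
  have o: "on_ob (path_functor Y \<phi>) = \<phi> 0"
    by (simp add: path_functor_def)
  show ?thesis
  proof
    fix x assume x: "x \<in> ob (path_category X)"
    then show "on_ob (path_functor Y \<phi>) x \<in> ob (path_category Y)"
      by (simp add: o path_category_def map_closed)
    have "is_path X (x, [], x)"
      using x by (auto simp: path_category_def intro: is_path.empty)
    then show "on_hom (path_functor Y \<phi>) (ident (path_category X) x)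
        = ident (path_category Y) (on_ob (path_functor Y \<phi>) x)"
      using on_hom_path_class by (simp add: o path_category_def)
  next
    fix x y f assume "f \<in> hom (path_category X) x y"
    then obtain es where "f = path_class X (x, es, y)" "is_path X (x, es, y)"
      by (auto simp: path_category_def)
    then show "on_hom (path_functor Y \<phi>) f \<in> hom (path_category Y)
        (on_ob (path_functor Y \<phi>) x) (on_ob (path_functor Y \<phi>) y)"
      using on_hom_path_class is_path_map by (fastforce simp: o path_category_def)
  next
    fix x y z f g
    assume "f \<in> hom (path_category X) x y" "g \<in> hom (path_category X) y z"
    then obtain es fs where *: "f = path_class X (x, es, y)" "is_path X (x, es, y)"
      "g = path_class X (y, fs, z)" "is_path X (y, fs, z)"
      by (auto simp: path_category_def)
    show "on_hom (path_functor Y \<phi>) (cmp (path_category X) g f)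
        = cmp (path_category Y) (on_hom (path_functor Y \<phi>) g) (on_hom (path_functor Y \<phi>) f)"
      using is_path_map[OF *(2)] is_path_map[OF *(4)] is_path_append[OF *(2,4)]
      by (simp add: * on_hom_path_class cmp_path_class X.simplicial_set_axioms
          Y.simplicial_set_axioms)
  qed
qed

lemma simplicial_map_triangulation:
  assumes K: "cubical_complex m K" and \<alpha>: "mono_on (Pow {1..m}) \<alpha>"
  shows "simplicial_map (triangulation K) (triangulation (cubical_image \<alpha> K)) (nerve_map \<alpha>)"
proof -
  interpret X: simplicial_set "triangulation K"
    by (rule simplicial_set_triangulation)
  interpret Y: simplicial_set "triangulation (cubical_image \<alpha> K)"
    by (rule simplicial_set_triangulation)
  show ?thesis
  proof
    fix x n assume "x \<in> simplices (triangulation K) n"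
    then obtain A B where AB: "A \<subseteq> B" "B \<subseteq> {1..m}" "{A..B} \<in> K"
      and x: "length x = Suc n" "set x \<subseteq> {A..B}" "sorted_wrt (\<le>) x"
      using K unfolding cubical_complex_def simplices_triangulation nerve_def by fastforce
    have sub: "{A..B} \<subseteq> Pow {1..m}"
      using AB(2) by (meson atLeastAtMost_iff order_trans PowI subsetI)
    have mono: "F \<subseteq> G \<Longrightarrow> F \<in> {A..B} \<Longrightarrow> G \<in> {A..B} \<Longrightarrow> \<alpha> F \<subseteq> \<alpha> G" for F G
      using mono_onD[OF \<alpha>] sub by blast
    have "sorted_wrt (\<lambda>F G. \<alpha> F \<subseteq> \<alpha> G) x"
      using x(3) by (rule sorted_wrt_mono_rel[rotated]) (use mono x(2) in blast)
    moreover have "\<alpha> ` {A..B} \<subseteq> {\<alpha> A..\<alpha> B}"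
      using AB(1) mono by auto
    moreover have "{\<alpha> A..\<alpha> B} \<in> cubical_image \<alpha> K"
      using AB mono[OF AB(1)] unfolding cubical_image_def by auto
    ultimately show "nerve_map \<alpha> n x \<in> simplices (triangulation (cubical_image \<alpha> K)) n"
      using x unfolding simplices_triangulation nerve_map_def nerve_def
      by (auto simp: sorted_wrt_map intro!: bexI[of _ "{\<alpha> A..\<alpha> B}"])
  qed (simp_all add: nerve_map_def triangulation_def nerve_def take_map drop_map)
qed

end

theory Submission
  imports Defs
begin

text \<open>
  Since \<open>\<alpha>\<close> preserves meets, \<open>\<rho> D\<close>, the least \<open>A\<close> with \<open>D \<subseteq> \<alpha> A\<close>, is left adjoint to \<open>\<alpha>\<close>; it
  maps \<open>{\<alpha> A..\<alpha> B}\<close> to \<open>{A..B}\<close>, so it induces a functor \<open>\<rho>\<^sub>*\<close> from \<open>P(K\<^sub>\<alpha>)\<close> to \<open>P(K)\<close>, and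
  \<open>\<rho>\<^sub>* \<alpha>\<^sub>* = id\<close>. The inclusions \<open>D \<subseteq> \<alpha> (\<rho> D)\<close> lie in the same cells, so they form a natural
  transformation from the identity to \<open>\<alpha>\<^sub>* \<rho>\<^sub>*\<close> that is the identity at the vertices \<open>\<alpha> F\<close>.
  Naturality gives \<open>f = \<alpha>\<^sub>* (\<rho>\<^sub>* f)\<close> for each \<open>f\<close> between such vertices.
\<close>

section \<open>Natural transformations and deformation retracts on path categories\<close>

text \<open>Naturality on the generating edges extends to all paths: the squares of consecutive
  edges are pasted along their common components \<open>h\<close>.\<close>

lemma path_rel_homotopy:
  assumes Y: "simplicial_set Y"
    and h: "\<And>v. v \<in> simplices Y 0 \<Longrightarrow> h v \<in> simplices Y 1 \<and> face Y 1 1 (h v) = v \<and> face Y 1 0 (h v) = \<theta> 0 v"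
    and \<theta>: "simplicial_map Y Y \<theta>"
    and natural: "\<And>e. e \<in> simplices Y 1 \<Longrightarrow>
      path_rel Y (face Y 1 1 e, [e, h (face Y 1 0 e)], \<theta> 0 (face Y 1 0 e))
        (face Y 1 1 e, [h (face Y 1 1 e), \<theta> 1 e], \<theta> 0 (face Y 1 0 e))"
    and p: "is_path Y (x, es, y)"
  shows "path_rel Y (x, es @ [h y], \<theta> 0 y) (x, h x # map (\<theta> 1) es, \<theta> 0 y)"
  using p
proof (induction "(x, es, y)" arbitrary: x es rule: is_path.induct)
  case empty
  then show ?case
    using is_path_single[OF Y, of "h y"] h[of y] by (auto intro: path_rel.refl)
next
  case (edge e es)
  let ?x = "face Y 1 1 e" and ?z = "face Y 1 0 e"
  have "is_path Y (\<theta> 0 ?z, map (\<theta> 1) es, \<theta> 0 y)"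
    using simplicial_map.is_path_map[OF \<theta> edge(2)] by simp
  \<comment> \<open>The square of \<open>e\<close>, extended by the image of the remaining path,
    carries \<open>h\<close> from the end of \<open>e\<close> back to its start.\<close>
  from path_rel.append[OF natural[OF edge(1)] path_rel.refl[OF this]]
  have "path_rel Y (?x, e # h ?z # map (\<theta> 1) es, \<theta> 0 y) (?x, h ?x # map (\<theta> 1) (e # es), \<theta> 0 y)"
    by simp
  \<comment> \<open>The induction hypothesis, preceded by \<open>e\<close>, carries \<open>h\<close>
    from \<open>y\<close> back to the end of \<open>e\<close>.\<close>
  moreover have "path_rel Y (?x, [e] @ es @ [h y], \<theta> 0 y) (?x, [e] @ h ?z # map (\<theta> 1) es, \<theta> 0 y)"
    by (rule path_rel.append[OF path_rel.refl[OF is_path_single[OF Y edge(1)]] edge(3)])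
  ultimately show ?case
    by (auto intro: path_rel.trans)
qed

lemma simplicial_map_compose:
  assumes "simplicial_map X Y \<phi>" and "simplicial_map Y Z \<psi>"
  shows "simplicial_map X Z (\<lambda>n x. \<psi> n (\<phi> n x))"
proof -
  interpret \<phi>: simplicial_map X Y \<phi> by fact
  interpret \<psi>: simplicial_map Y Z \<psi> by fact
  show ?thesis
    by unfold_locales
      (simp_all add: \<phi>.map_closed \<psi>.map_closed \<phi>.map_face \<psi>.map_face \<phi>.map_degen \<psi>.map_degen)
qed

text \<open>Faithfulness comes from the left inverse induced by \<psi>. For fullness, the components
  of \<open>h\<close> at the vertices \<open>\<phi> 0 x\<close> are identities, so naturality
  identifies a morphism between such vertices with the image of its retraction. The homotopy enters
  only as a natural transformation of path categories, hence as data on vertices and relations on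
  edges.\<close>

lemma fully_faithful_deformation_retract:
  assumes \<phi>: "simplicial_map X Y \<phi>" and \<psi>: "simplicial_map Y X \<psi>"
    and retract: "\<And>n x. x \<in> simplices X n \<Longrightarrow> \<psi> n (\<phi> n x) = x"
    and h: "\<And>v. v \<in> simplices Y 0 \<Longrightarrow>
      h v \<in> simplices Y 1 \<and> face Y 1 1 (h v) = v \<and> face Y 1 0 (h v) = \<phi> 0 (\<psi> 0 v)"
    and natural: "\<And>e. e \<in> simplices Y 1 \<Longrightarrow>
      path_rel Y (face Y 1 1 e, [e, h (face Y 1 0 e)], \<phi> 0 (\<psi> 0 (face Y 1 0 e)))
        (face Y 1 1 e, [h (face Y 1 1 e), \<phi> 1 (\<psi> 1 e)], \<phi> 0 (\<psi> 0 (face Y 1 0 e)))"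
    and stationary: "\<And>x. x \<in> simplices X 0 \<Longrightarrow> h (\<phi> 0 x) = degen Y 0 0 (\<phi> 0 x)"
  shows "fully_faithful (path_category X) (path_category Y) (path_functor Y \<phi>)"
proof -
  interpret \<phi>: simplicial_map X Y \<phi> by fact
  interpret \<psi>: simplicial_map Y X \<psi> by fact
  interpret F: cat_functor "path_category X" "path_category Y" "path_functor Y \<phi>"
    by (rule \<phi>.cat_functor_path_functor)
  note X = \<phi>.X.simplicial_set_axioms and Y = \<phi>.Y.simplicial_set_axioms
  have retract_path: "map_path \<psi> (map_path \<phi> p) = p" if "is_path X p" for p
    using that
  proof induction
    case (edge e es y)
    have "face X 1 1 e \<in> simplices X 0"
      using \<phi>.X.face_closed[of e 0 1] edge(1) by simp
    then show ?case
      using edge retract[of _ 0] retract[of e 1] by simp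
  qed (simp add: retract)
  have full: "path_rel Y (\<phi> 0 x, es, \<phi> 0 y) (\<phi> 0 x, map (\<phi> 1) (map (\<psi> 1) es), \<phi> 0 y)"
    if x: "x \<in> simplices X 0" and y: "y \<in> simplices X 0" and p: "is_path Y (\<phi> 0 x, es, \<phi> 0 y)"
    for x y es
  proof -
    let ?p = "map (\<phi> 1) (map (\<psi> 1) es)"
    have loop: "path_rel Y (\<phi> 0 v, [h (\<phi> 0 v)], \<phi> 0 v) (\<phi> 0 v, [], \<phi> 0 v)"
      if "v \<in> simplices X 0" for v
      using path_rel.degenerate[OF \<phi>.map_closed[OF that]] by (simp add: stationary[OF that])
    \<comment> \<open>The naturality square of \<open>es\<close> has trivial components at both ends
      by \<open>loop\<close>, so its two remaining sides \<open>es\<close> and \<open>?p\<close>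
      agree.\<close>
    have "path_rel Y (\<phi> 0 x, es @ [h (\<phi> 0 y)], \<phi> 0 y) (\<phi> 0 x, es @ [], \<phi> 0 y)"
      by (rule path_rel.append[OF path_rel.refl[OF p] loop[OF y]])
    moreover have "path_rel Y (\<phi> 0 x, es @ [h (\<phi> 0 y)], \<phi> 0 y) (\<phi> 0 x, h (\<phi> 0 x) # ?p, \<phi> 0 y)"
      using path_rel_homotopy[OF Y h simplicial_map_compose[OF \<psi> \<phi>] natural p]
      by (simp add: retract[OF y] o_def)
    moreover have "is_path Y (\<phi> 0 x, ?p, \<phi> 0 y)"
      using \<psi>.is_path_map[OF p] \<phi>.is_path_map[of "\<psi> 0 (\<phi> 0 x)" "map (\<psi> 1) es" "\<psi> 0 (\<phi> 0 y)"]
      by (simp add: retract[OF x] retract[OF y])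
    then have "path_rel Y (\<phi> 0 x, [h (\<phi> 0 x)] @ ?p, \<phi> 0 y) (\<phi> 0 x, [] @ ?p, \<phi> 0 y)"
      by (intro path_rel.append[OF loop[OF x]] path_rel.refl)
    ultimately show ?thesis
      by (auto intro: path_rel.sym path_rel.trans)
  qed
  show ?thesis
  proof
    fix x y assume "x \<in> ob (path_category X)" "y \<in> ob (path_category X)"
    then have x: "x \<in> simplices X 0" and y: "y \<in> simplices X 0"
      by (simp_all add: path_category_def)
    show "bij_betw (on_hom (path_functor Y \<phi>)) (hom (path_category X) x y)
        (hom (path_category Y) (on_ob (path_functor Y \<phi>) x) (on_ob (path_functor Y \<phi>) y))"
      unfolding bij_betw_def
    proof
      show "inj_on (on_hom (path_functor Y \<phi>)) (hom (path_category X) x y)"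
      proof
        fix f g assume "f \<in> hom (path_category X) x y" "g \<in> hom (path_category X) x y"
          and eq: "on_hom (path_functor Y \<phi>) f = on_hom (path_functor Y \<phi>) g"
        then obtain es fs where f: "f = path_class X (x, es, y)" "is_path X (x, es, y)"
          and g: "g = path_class X (x, fs, y)" "is_path X (x, fs, y)"
          by (auto simp: path_category_def)
        have "path_class Y (map_path \<phi> (x, es, y)) = path_class Y (map_path \<phi> (x, fs, y))"
          using eq by (simp only: f g \<phi>.on_hom_path_class)
        then have "path_rel Y (map_path \<phi> (x, es, y)) (map_path \<phi> (x, fs, y))"
          using path_rel.refl[OF \<phi>.is_path_map[OF g(2)]] unfolding path_class_def by blast
        \<comment> \<open>By \<open>retract_path\<close>, applying \<psi> recovers the two original
          paths themselves, not merely equivalent ones.\<close>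
        from \<psi>.path_rel_map[OF this] show "f = g"
          by (simp only: retract_path f(2) g(2)) (simp only: f(1) g(1) path_class_eqI)
      qed
      show "on_hom (path_functor Y \<phi>) ` hom (path_category X) x y
          = hom (path_category Y) (on_ob (path_functor Y \<phi>) x) (on_ob (path_functor Y \<phi>) y)"
      proof
        show "on_hom (path_functor Y \<phi>) ` hom (path_category X) x y
            \<subseteq> hom (path_category Y) (on_ob (path_functor Y \<phi>) x) (on_ob (path_functor Y \<phi>) y)"
          using F.on_hom_closed[OF \<open>x \<in> ob _\<close> \<open>y \<in> ob _\<close>] by blast
        show "hom (path_category Y) (on_ob (path_functor Y \<phi>) x) (on_ob (path_functor Y \<phi>) y)
            \<subseteq> on_hom (path_functor Y \<phi>) ` hom (path_category X) x y"
        proof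
          fix f
          assume "f \<in> hom (path_category Y) (on_ob (path_functor Y \<phi>) x) (on_ob (path_functor Y \<phi>) y)"
          then obtain es where f: "f = path_class Y (\<phi> 0 x, es, \<phi> 0 y)"
            and p: "is_path Y (\<phi> 0 x, es, \<phi> 0 y)"
            by (auto simp: path_category_def path_functor_def)
          \<comment> \<open>The preimage of \<open>f\<close> is its retraction along \<psi>; the
            endpoints are right because \<psi> undoes \<phi> on vertices of
            \<open>X\<close>.\<close>
          have q: "is_path X (x, map (\<psi> 1) es, y)"
            using \<psi>.is_path_map[OF p] by (simp add: retract[OF x] retract[OF y])
          have "f = on_hom (path_functor Y \<phi>) (path_class X (x, map (\<psi> 1) es, y))"
            using path_class_eqI[OF full[OF x y p]] \<phi>.on_hom_path_class[OF q] by (simp add: f)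
          then show "f \<in> on_hom (path_functor Y \<phi>) ` hom (path_category X) x y"
            using q by (auto simp: path_category_def)
        qed
      qed
    qed
  qed
qed

section \<open>Simplicial maps and relations in triangulations\<close>

text \<open>Every simplex is a chain inside a single cell, so order and location of images need
  control only cell by cell.\<close>

lemma simplicial_map_nerve_map:
  assumes cells: "\<And>c. c \<in> L \<Longrightarrow> mono_on c \<rho> \<and> (\<exists>d\<in>K. \<rho> ` c \<subseteq> d)"
  shows "simplicial_map (triangulation L) (triangulation K) (nerve_map \<rho>)"
proof -
  interpret X: simplicial_set "triangulation L"
    by (rule simplicial_set_triangulation)
  interpret Y: simplicial_set "triangulation K"
    by (rule simplicial_set_triangulation)
  show ?thesis
  proof
    fix x n assume "x \<in> simplices (triangulation L) n"
    then obtain c where c: "c \<in> L" and x: "length x = Suc n" "set x \<subseteq> c" "sorted_wrt (\<le>) x"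
      by (auto simp: simplices_triangulation simplices_nerve)
    obtain d where d: "d \<in> K" "\<rho> ` c \<subseteq> d"
      using cells[OF c] by blast
    have "sorted_wrt (\<lambda>F G. \<rho> F \<le> \<rho> G) x"
      using x(3) by (rule sorted_wrt_mono_rel[rotated]) (use cells[OF c] x(2) in \<open>blast dest: mono_onD\<close>)
    then show "nerve_map \<rho> n x \<in> simplices (triangulation K) n"
      using x d by (auto simp: simplices_triangulation simplices_nerve nerve_map_def sorted_wrt_map)
  qed (simp_all add: nerve_map_def triangulation_def nerve_def take_map drop_map)
qed

text \<open>This is the relation of the 2-simplex \<open>[D, E, F]\<close>, which belongs to the
  triangulation because one cell contains all three vertices.\<close>

lemma path_rel_chain:
  assumes c: "c \<in> K" and D: "{D, E, F} \<subseteq> c" "D \<le> E" "E \<le> F"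
  shows "path_rel (triangulation K) ([D], [[D, F]], [F]) ([D], [[D, E], [E, F]], [F])"
proof -
  have "[D, E, F] \<in> simplices (triangulation K) 2"
    using assms by (auto simp: simplices_triangulation simplices_nerve)
  from path_rel.triangle[OF this] show ?thesis
    by (simp add: triangulation_def nerve_def numeral_2_eq_2)
qed

section \<open>The left adjoint of a meet-preserving embedding\<close>

lemma Inter_in_Inter_closed:
  assumes "finite S" "S \<noteq> {}" "S \<subseteq> T" and "\<And>A B. A \<in> T \<Longrightarrow> B \<in> T \<Longrightarrow> A \<inter> B \<in> T"
  shows "\<Inter>S \<in> T"
  using assms(1-3) by (induction rule: finite_ne_induct) (auto intro: assms(4))

text \<open>The sets \<open>A\<close> with \<open>D \<subseteq> \<alpha> A\<close> form a finite
  family closed under intersection and containing \<open>{1..m}\<close>, so their intersection is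
  its least member.\<close>

lemma left_adjoint_of_meet_embedding:
  fixes \<alpha> :: "nat set \<Rightarrow> 'a set"
  assumes mono: "mono_on (Pow {1..m}) \<alpha>" and inj: "inj_on \<alpha> (Pow {1..m})"
    and meet: "\<And>A B. \<lbrakk>A \<subseteq> {1..m}; B \<subseteq> {1..m}\<rbrakk> \<Longrightarrow> \<alpha> (A \<inter> B) = \<alpha> A \<inter> \<alpha> B"
  obtains \<rho> where "mono_on (Pow (\<alpha> {1..m})) \<rho>" and "\<And>A. A \<subseteq> {1..m} \<Longrightarrow> \<rho> (\<alpha> A) = A"
    and "\<And>D. D \<subseteq> \<alpha> {1..m} \<Longrightarrow> D \<subseteq> \<alpha> (\<rho> D)"
proof
  \<comment> \<open>If \<open>D\<close> is not contained in \<open>\<alpha> {1..m}\<close>, this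
    family is empty and its intersection is \<open>UNIV\<close>; the unit is therefore claimed only
    for subsets of \<open>\<alpha> {1..m}\<close>.\<close>
  define S where "S D = {A. A \<subseteq> {1..m} \<and> D \<subseteq> \<alpha> A}" for D
  show "mono_on (Pow (\<alpha> {1..m})) (\<lambda>D. \<Inter>(S D))"
    by (rule mono_onI, rule Inter_anti_mono) (auto simp: S_def)
  show "\<Inter>(S (\<alpha> A)) = A" if A: "A \<subseteq> {1..m}" for A
  proof -
    \<comment> \<open>\<alpha> reflects the order, since \<open>A \<subseteq> B\<close> can be
      expressed as \<open>A \<inter> B = A\<close> and \<alpha> preserves meets and is
      injective.\<close>
    have "A \<subseteq> B" if B: "B \<subseteq> {1..m}" "\<alpha> A \<subseteq> \<alpha> B" for B
    proof -
      have "\<alpha> (A \<inter> B) = \<alpha> A"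
        using meet[OF A B(1)] B(2) by blast
      then have "A \<inter> B = A"
        using A by (intro inj_onD[OF inj]) auto
      then show ?thesis by blast
    qed
    then show ?thesis
      using A by (auto simp: S_def)
  qed
  show "D \<subseteq> \<alpha> (\<Inter>(S D))" if "D \<subseteq> \<alpha> {1..m}" for D
  proof -
    have "finite (S D)"
      by (rule finite_subset[of _ "Pow {1..m}"]) (auto simp: S_def)
    moreover have "{1..m} \<in> S D"
      using that by (simp add: S_def)
    moreover have "A \<inter> B \<in> S D" if "A \<in> S D" "B \<in> S D" for A B
      using that meet[of A B] by (auto simp: S_def)
    ultimately have "\<Inter>(S D) \<in> S D"
      by (intro Inter_in_Inter_closed) auto
    then show ?thesis by (simp add: S_def)
  qed
qed

section \<open>The retraction of the image complex onto \<open>K\<close>\<close>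

theorem lemma14:
  fixes m n :: nat
    and \<alpha> :: "nat set \<Rightarrow> nat set"
    and K :: "nat set set set"
  assumes "\<alpha> ` Pow {1..m} \<subseteq> Pow {1..n}"
    and "mono_on (Pow {1..m}) \<alpha>"
    and "inj_on \<alpha> (Pow {1..m})"
    and "\<And>A B. \<lbrakk>A \<subseteq> {1..m}; B \<subseteq> {1..m}\<rbrakk> \<Longrightarrow> \<alpha> (A \<inter> B) = \<alpha> A \<inter> \<alpha> B"
    and "\<And>A B. \<lbrakk>A \<subseteq> {1..m}; B \<subseteq> {1..m}\<rbrakk> \<Longrightarrow> \<alpha> (A \<union> B) = \<alpha> A \<union> \<alpha> B"
    and "cubical_complex m K"
  shows "fully_faithful (cubical_path_category K)
           (cubical_path_category (cubical_image \<alpha> K))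
           (cubical_path_functor \<alpha> K)"
proof -
  let ?L = "cubical_image \<alpha> K"
  let ?X = "triangulation K" and ?Y = "triangulation ?L"
  obtain \<rho> where \<rho>_mono: "mono_on (Pow (\<alpha> {1..m})) \<rho>"
    and \<rho>\<alpha>: "\<And>A. A \<subseteq> {1..m} \<Longrightarrow> \<rho> (\<alpha> A) = A"
    and unit: "\<And>D. D \<subseteq> \<alpha> {1..m} \<Longrightarrow> D \<subseteq> \<alpha> (\<rho> D)"
    using left_adjoint_of_meet_embedding[OF assms(2-4)] by blast
  have \<alpha>_mono: "\<alpha> A \<subseteq> \<alpha> B" if "A \<subseteq> B" "B \<subseteq> {1..m}" for A B
    using mono_onD[OF assms(2), of A B] that by auto
  have \<rho>_mono': "\<rho> D \<subseteq> \<rho> E" if "D \<subseteq> E" "E \<subseteq> \<alpha> {1..m}" for D E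
    using mono_onD[OF \<rho>_mono, of D E] that by auto
  \<comment> \<open>The unit may lead from \<open>D\<close> out of the small cell \<open>c\<close>,
    but not out of an enclosing cell \<open>{\<alpha> A..\<alpha> B}\<close>; later arguments work
    in the latter.\<close>
  have cell: thesis
    if c: "c \<in> ?L" and that: "\<And>A B. \<lbrakk>A \<subseteq> B; B \<subseteq> {1..m}; {A..B} \<in> K; {\<alpha> A..\<alpha> B} \<in> ?L;
      c \<subseteq> {\<alpha> A..\<alpha> B}\<rbrakk> \<Longrightarrow> thesis" for c thesis
  proof -
    obtain C D A B where *: "c = {C..D}" "A \<subseteq> B" "{A..B} \<in> K" "\<alpha> A \<subseteq> C" "D \<subseteq> \<alpha> B"
      using c unfolding cubical_image_def by blast
    have B: "B \<subseteq> {1..m}"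
      using assms(6) *(2,3) unfolding cubical_complex_def by (metis Icc_eq_Icc)
    have "{\<alpha> A..\<alpha> B} \<in> ?L"
      using *(2,3) \<alpha>_mono[OF *(2) B] unfolding cubical_image_def by auto
    then show ?thesis
      using * B by (intro that[of A B]) auto
  qed
  have interval: "D \<subseteq> \<alpha> {1..m}" "\<rho> D \<in> {A..B}" "\<alpha> (\<rho> D) \<in> {\<alpha> A..\<alpha> B}" "D \<subseteq> \<alpha> (\<rho> D)"
    if AB: "A \<subseteq> B" "B \<subseteq> {1..m}" and D: "D \<in> {\<alpha> A..\<alpha> B}" for A B D
  proof -
    show D': "D \<subseteq> \<alpha> {1..m}"
      using D \<alpha>_mono[OF AB(2)] by auto
    have "\<alpha> A \<subseteq> D" "D \<subseteq> \<alpha> B"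
      using D by auto
    \<comment> \<open>Since \<rho> undoes \<alpha>, applying \<rho> to the bounds of
      \<open>D\<close> gives \<open>A \<subseteq> \<rho> D \<subseteq> B\<close>.\<close>
    then have "\<rho> (\<alpha> A) \<subseteq> \<rho> D" "\<rho> D \<subseteq> \<rho> (\<alpha> B)"
      using \<rho>_mono'[of "\<alpha> A" D] \<rho>_mono'[of D "\<alpha> B"] D' \<alpha>_mono[OF AB(2) order_refl] by simp_all
    then show \<rho>: "\<rho> D \<in> {A..B}"
      using AB by (auto simp: \<rho>\<alpha>)
    then show "\<alpha> (\<rho> D) \<in> {\<alpha> A..\<alpha> B}"
      using AB(2) \<alpha>_mono[of A "\<rho> D"] \<alpha>_mono[of "\<rho> D" B] by auto
    show "D \<subseteq> \<alpha> (\<rho> D)"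
      by (rule unit[OF D'])
  qed
  have vertex: "F \<subseteq> {1..m}" if "xs \<in> simplices ?X k" "F \<in> set xs" for xs k F
    using triangulation_subset_nerve[OF assms(6), of k] that by (auto simp: simplices_nerve)
  have \<rho>_map: "simplicial_map ?Y ?X (nerve_map \<rho>)"
  proof (rule simplicial_map_nerve_map)
    fix c assume "c \<in> ?L"
    then obtain A B where AB: "A \<subseteq> B" "B \<subseteq> {1..m}" "{A..B} \<in> K" "c \<subseteq> {\<alpha> A..\<alpha> B}"
      by (rule cell)
    have "mono_on c \<rho>"
      by (rule mono_on_subset[OF \<rho>_mono]) (use AB(4) interval(1)[OF AB(1,2)] in blast)
    moreover have "\<rho> ` c \<subseteq> {A..B}"
      using interval(2)[OF AB(1,2)] AB(4) by blast
    ultimately show "mono_on c \<rho> \<and> (\<exists>d\<in>K. \<rho> ` c \<subseteq> d)"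
      using AB(3) by blast
  qed
  \<comment> \<open>A vertex is a one-element list; \<open>h\<close> assigns to it the edge given by
    the unit at its entry.\<close>
  define h where "h v = [hd v, \<alpha> (\<rho> (hd v))]" for v
  show ?thesis
    unfolding cubical_path_category_def cubical_path_functor_def
  proof (rule fully_faithful_deformation_retract[where \<psi> = "nerve_map \<rho>" and h = h])
    show "simplicial_map ?X ?Y (nerve_map \<alpha>)"
      by (rule simplicial_map_triangulation[OF assms(6,2)])
    show "simplicial_map ?Y ?X (nerve_map \<rho>)"
      by (rule \<rho>_map)
    show "nerve_map \<rho> k (nerve_map \<alpha> k xs) = xs" if "xs \<in> simplices ?X k" for k xs
      using vertex[OF that] by (auto simp: nerve_map_def \<rho>\<alpha> intro: map_idI)
  next
    fix v assume "v \<in> simplices ?Y 0"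
    then obtain D c where D: "v = [D]" "c \<in> ?L" "D \<in> c"
      by (auto simp: simplices_triangulation simplices_nerve length_Suc_conv)
    then obtain A B where AB: "A \<subseteq> B" "B \<subseteq> {1..m}" "{\<alpha> A..\<alpha> B} \<in> ?L" "D \<in> {\<alpha> A..\<alpha> B}"
      using cell[OF D(2)] by (metis subsetD)
    have "[D, \<alpha> (\<rho> D)] \<in> simplices (nerve {\<alpha> A..\<alpha> B}) 1"
      using AB(4) interval(3,4)[OF AB(1,2,4)] by (auto simp: simplices_nerve)
    with AB(3) show "h v \<in> simplices ?Y 1 \<and> face ?Y 1 1 (h v) = v
        \<and> face ?Y 1 0 (h v) = nerve_map \<alpha> 0 (nerve_map \<rho> 0 v)"
      by (auto simp: h_def D(1) nerve_map_def simplices_triangulation)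
        (simp_all add: triangulation_def nerve_def)
  next
    fix e assume "e \<in> simplices ?Y 1"
    then obtain D E c where e: "e = [D, E]" "c \<in> ?L" "{D, E} \<subseteq> c" "D \<subseteq> E"
      by (auto simp: simplices_triangulation simplices_nerve length_Suc_conv)
    then obtain A B where AB: "A \<subseteq> B" "B \<subseteq> {1..m}" "{\<alpha> A..\<alpha> B} \<in> ?L"
      and D: "D \<in> {\<alpha> A..\<alpha> B}" and E: "E \<in> {\<alpha> A..\<alpha> B}"
      using cell[OF e(2)] by (metis insert_subset subsetD)
    note iD = interval[OF AB(1,2) D] and iE = interval[OF AB(1,2) E]
    have "\<alpha> (\<rho> D) \<subseteq> \<alpha> (\<rho> E)"
      using iE(1,2) AB(2) by (intro \<alpha>_mono \<rho>_mono' e(4)) auto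
    \<comment> \<open>The naturality square is cut along the diagonal
      \<open>[D, \<alpha> (\<rho> E)]\<close> into two 2-simplices, both in the cell
      \<open>{\<alpha> A..\<alpha> B}\<close>.\<close>
    then have "path_rel ?Y ([D], [[D, \<alpha> (\<rho> E)]], [\<alpha> (\<rho> E)])
        ([D], [[D, \<alpha> (\<rho> D)], [\<alpha> (\<rho> D), \<alpha> (\<rho> E)]], [\<alpha> (\<rho> E)])"
      using D iD iE by (intro path_rel_chain[OF AB(3)]) auto
    moreover have "path_rel ?Y ([D], [[D, \<alpha> (\<rho> E)]], [\<alpha> (\<rho> E)])
        ([D], [[D, E], [E, \<alpha> (\<rho> E)]], [\<alpha> (\<rho> E)])"
      using D E iE e(4) by (intro path_rel_chain[OF AB(3)]) auto
    ultimately have "path_rel ?Y ([D], [[D, E], [E, \<alpha> (\<rho> E)]], [\<alpha> (\<rho> E)])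
        ([D], [[D, \<alpha> (\<rho> D)], [\<alpha> (\<rho> D), \<alpha> (\<rho> E)]], [\<alpha> (\<rho> E)])"
      by (blast intro: path_rel.sym path_rel.trans)
    moreover have "face ?Y 1 1 e = [D]" "face ?Y 1 0 e = [E]"
      by (simp_all add: e(1) triangulation_def nerve_def)
    ultimately show "path_rel ?Y
        (face ?Y 1 1 e, [e, h (face ?Y 1 0 e)], nerve_map \<alpha> 0 (nerve_map \<rho> 0 (face ?Y 1 0 e)))
        (face ?Y 1 1 e, [h (face ?Y 1 1 e), nerve_map \<alpha> 1 (nerve_map \<rho> 1 e)],
          nerve_map \<alpha> 0 (nerve_map \<rho> 0 (face ?Y 1 0 e)))"
      by (simp add: h_def nerve_map_def e(1))
  next
    fix v assume v: "v \<in> simplices ?X 0"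
    then obtain F where F: "v = [F]"
      by (auto simp: simplices_triangulation simplices_nerve length_Suc_conv)
    \<comment> \<open>At \<open>\<alpha> F\<close> the unit is an equality because
      \<open>\<rho> (\<alpha> F) = F\<close>, so its edge repeats one vertex.\<close>
    then show "h (nerve_map \<alpha> 0 v) = degen ?Y 0 0 (nerve_map \<alpha> 0 v)"
      using vertex[OF v, of F] by (simp add: h_def nerve_map_def \<rho>\<alpha> triangulation_def nerve_def)
  qed
qed

end
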